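(* Let $\lambda$ be a nonzero real number. For all $n,k\in\mathbb{N}$, $$\binom{k-\lambda}{k}H_{n,\lambda}^{(k+1)}=\binom{n+k}{k}\Big(H_{n+k,\lambda}-H_{k,\lambda}\Big).$$
   Context: $\mathbb{N}=\{1,2,3,\dots\}$. For real $a$ and integer $k\ge0$, $\binom{a}{k}=a(a-1)\cdots(a-k+1)/k!$. Degenerate harmonic numbers: $H_{0,\lambda}=0$ and $H_{n,\lambda}=\sum_{k=1}^{n}\frac{1}{\lambda}\binom{\lambda}{k}(-1)^{k-1}$ for $n\ge1$. Degenerate hyperharmonic numbers: $H_{n,\lambda}^{(1)}=H_{n,\lambda}$; $H_{0,\lambda}^{(r)}=0$ for $r\ge1$; $H_{n,\lambda}^{(r)}=\sum_{k=1}^{n}H_{k,\lambda}^{(r-1)}$ for $r\ge2$, $n\ge1$. *)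

theory Defs
  imports Complex_Main
begin

(* For n = 0 the sum is empty, which gives the convention that the zeroth number is 0. *)
definition degen_harm :: "real \<Rightarrow> nat \<Rightarrow> real" where
  "degen_harm l n = (\<Sum>k = 1..n. (1 / l) * (l gchoose k) * (-1) ^ (k - 1))"

(* degen_hyperharm l r n is the n-th degenerate hyperharmonic number of order r >= 1;
   order 0 is deliberately left unspecified. At n = 0 the value is 0 for every r >= 1,
   again by the empty sum. *)
fun degen_hyperharm :: "real \<Rightarrow> nat \<Rightarrow> nat \<Rightarrow> real" where
  "degen_hyperharm l (Suc 0) n = degen_harm l n"
| "degen_hyperharm l (Suc (Suc r)) n = (\<Sum>k = 1..n. degen_hyperharm l (Suc r) k)"

end

theory Submission imports Defs begin

text \<open>
  Each order of summation can be carried out explicitly. The alternating partial sums of a row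
  of generalized binomial coefficients are again such coefficients, which gives
  \<open>degen_harm l n = (1 - ((n - l) gchoose n)) / l\<close>. Summing over \<open>n\<close> again and again stays inside
  this family by the parallel (hockey-stick) summation formula, so the numbers of order \<open>r + 1\<close>
  are \<open>(((r + n) gchoose n) - ((r + n - l) gchoose n)) / l\<close>
  (lemma \<open>degen_hyperharm_closed_form\<close>).

  Inserting both closed forms, the constant parts match on the two sides after multiplication
  by \<open>(k - l) gchoose k\<close>, and the rest is the trinomial revision identity for the upper
  parameter \<open>n + k - l\<close> (lemma \<open>gchoose_shift_product\<close>). No step divides by
  \<open>(k - l) gchoose k\<close>, which vanishes when \<open>l\<close> is one of \<open>1, \<dots>, k\<close>.
\<close>

text \<open>
  The term with index \<open>0\<close>, missing from the definition, accounts for the \<open>1\<close>; negating the upper index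
  absorbs the sign \<open>(-1) ^ n\<close> that the partial sum carries.
\<close>

lemma degen_harm_closed_form:
  "degen_harm l n = (1 - ((real n - l) gchoose n)) / l"
proof -
  have "(\<Sum>k\<le>n. (l gchoose k) * (-1) ^ k) = (-1) ^ n * ((l - 1) gchoose n)"
    by (rule gbinomial_sum_lower_neg)
  also have "\<dots> = (real n - l) gchoose n"
    by (subst gbinomial_negated_upper) (simp flip: mult.assoc power_add)
  finally have row: "(\<Sum>k\<le>n. (l gchoose k) * (-1) ^ k) = (real n - l) gchoose n" .
  have "degen_harm l n = (\<Sum>k = 1..n. - (1 / l) * ((l gchoose k) * (-1) ^ k))"
    unfolding degen_harm_def
  proof (intro sum.cong refl)
    fix k assume "k \<in> {1..n}"
    then obtain j where "k = Suc j" by (cases k) auto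
    then show "1 / l * (l gchoose k) * (-1) ^ (k - 1) = - (1 / l) * ((l gchoose k) * (-1) ^ k)"
      by simp
  qed
  also have "\<dots> = - (1 / l) * ((\<Sum>k\<le>n. (l gchoose k) * (-1) ^ k) - 1)"
    unfolding sum_distrib_left[symmetric]
    by (simp add: atMost_atLeast0 sum.atLeast_Suc_atMost)
  finally show ?thesis
    unfolding row by (simp add: diff_divide_distrib)
qed

text \<open>
  Parallel summation applies to both binomial terms. The sum defining the numbers starts at \<open>1\<close>,
  but at \<open>0\<close> both terms equal \<open>1\<close> and cancel.
\<close>

lemma degen_hyperharm_closed_form:
  "degen_hyperharm l (Suc r) n
     = (((real r + real n) gchoose n) - ((real r + real n - l) gchoose n)) / l"
proof (induction r arbitrary: n)
  case 0
  have "real n gchoose n = 1"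
    by (simp flip: binomial_gbinomial)
  then show ?case
    by (simp add: degen_harm_closed_form)
next
  case (Suc r)
  have "degen_hyperharm l (Suc (Suc r)) n
      = (\<Sum>k = 1..n. (((real r + real k) gchoose k) - ((real r - l + real k) gchoose k)) / l)"
    by (simp add: Suc.IH algebra_simps)
  also have "\<dots>
      = (\<Sum>k\<le>n. (((real r + real k) gchoose k) - ((real r - l + real k) gchoose k)) / l)"
    by (simp add: atMost_atLeast0 sum.atLeast_Suc_atMost)
  also have "\<dots> = ((\<Sum>k\<le>n. (real r + real k) gchoose k)
                  - (\<Sum>k\<le>n. (real r - l + real k) gchoose k)) / l"
    by (simp add: sum_subtractf flip: sum_divide_distrib)
  also have "\<dots> = (((real r + real n + 1) gchoose n) - ((real r - l + real n + 1) gchoose n)) / l"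
    by (simp only: gbinomial_parallel_sum)
  finally show ?case
    by (simp add: algebra_simps)
qed

lemma real_gchoose_eq_choose_complement:
  "real (n + k) gchoose n = real ((n + k) choose k)"
  using binomial_symmetric[of n "n + k"] by (simp flip: binomial_gbinomial del: of_nat_add)

text \<open>
  Both sides are the falling product \<open>(n + k - l) \<cdots> (1 - l)\<close> divided by \<open>n! k!\<close>.
\<close>

lemma gchoose_shift_product:
  fixes l :: real
  shows "((real k - l) gchoose k) * ((real k + real n - l) gchoose n)
       = real ((n + k) choose k) * ((real (n + k) - l) gchoose (n + k))"
proof -
  have "(real (n + k) - l gchoose (n + k)) * (real (n + k) gchoose n)
      = (real (n + k) - l gchoose n) * (real (n + k) - l - real n gchoose (n + k - n))"
    by (rule gbinomial_trinomial_revision) simp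
  then show ?thesis
    unfolding real_gchoose_eq_choose_complement by (simp add: algebra_simps)
qed

theorem corollary8:
  fixes l :: real and n k :: nat
  assumes "l \<noteq> 0" and "n \<ge> 1" and "k \<ge> 1"
  shows "((real k - l) gchoose k) * degen_hyperharm l (k + 1) n
       = real ((n + k) choose k) * (degen_harm l (n + k) - degen_harm l k)"
proof -
  let ?c = "(real k - l) gchoose k" and ?b = "real ((n + k) choose k)"
  have b: "(real k + real n) gchoose n = ?b"
    using real_gchoose_eq_choose_complement[of n k] by (simp add: add.commute)
  have "?c * degen_hyperharm l (k + 1) n
      = (?b * ?c - ?c * ((real k + real n - l) gchoose n)) / l"
    by (simp add: degen_hyperharm_closed_form b algebra_simps)
  also have "\<dots> = ?b * (?c - ((real (n + k) - l) gchoose (n + k))) / l"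
    unfolding gchoose_shift_product by (simp add: algebra_simps)
  also have "\<dots> = ?b * (degen_harm l (n + k) - degen_harm l k)"
    by (simp add: degen_harm_closed_form flip: diff_divide_distrib)
  finally show ?thesis .
qed

end
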